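(* The class $\mathcal K_\omega$ of all countable local orders $(O,\to)$ has the automorphic Borel amalgamation property (ABAP).
   Context: A local order is a tournament $(O,\to)$ (for distinct $x,y$ exactly one of $x\to y$, $y\to x$ holds) such that for every vertex $x$, the set of predecessors of $x$ and the set of successors of $x$ are each linearly ordered by $\to$. ABAP. Let $\mathcal K_\omega$ be a class of countable relational structures in a fixed countable relational language, closed under isomorphism; it is regarded as a standard Borel space in the usual way (coding structures with universe a subset of $\mathbb N$). For $A\in\mathcal K_\omega$, a quantifier-free type $\tau(x)$ in one free variable with finitely many parameters from $A$ is an admissible finite type over $A$ if there is $B\in\mathcal K_\omega$ with $A$ a substructure of $B$ and $B$ containing an element realizing $\tau$. The class $\mathcal K_\omega$ has the ABAP if there is a Borel map $E$ on $\mathcal K_\omega$ such that: (a) for every $A\in\mathcal K_\omega$, $E(A)\in\mathcal K_\omega$ is an extension of $A$ containing witnesses for all admissible finite types over $A$; (b) there is a Borel assignment $(A,\phi)\mapsto\tilde\phi$, from pairs with $A\in\mathcal K_\omega$ and $\phi\in\mathrm{Aut}(A)$, to $\tilde\phi\in\mathrm{Aut}(E(A))$ such that $\phi\subseteq\tilde\phi$ and $\tilde\phi$ has no fixed points in $E(A)\setminus A$; (c) there is an assignment $(A_0,A_1,\alpha)\mapsto\hat\alpha$, from triples with $A_i\in\mathcal K_\omega$ and $\alpha\colon A_0\cong A_1$ an isomorphism, to isomorphisms $\hat\alpha\colon E(A_0)\cong E(A_1)$ extending $\alpha$, such that whenever $\phi_i\in\mathrm{Aut}(A_i)$ and $\alpha\phi_0=\phi_1\alpha$,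 we have $\hat\alpha\tilde\phi_0=\tilde\phi_1\hat\alpha$. *)

theory Defs
  imports "HOL-Analysis.Analysis"
begin

section \<open>Countable relational structures as points of a standard Borel space\<close>

text \<open>
  A relational language is a countable type of relation symbols together with an arity function.
  A countable structure is coded by the characteristic functions of its universe, a subset of the
  natural numbers (possibly empty), and of its relations.  The type of codes carries
  the product topology, hence \<^const>\<open>borel\<close> is the usual Borel structure on the space of codes.
\<close>

type_synonym 'r code = "(nat \<Rightarrow> bool) \<times> ('r \<Rightarrow> nat list \<Rightarrow> bool)"

definition universe :: "'r code \<Rightarrow> nat set" where
  "universe A = {n. fst A n}"

definition rel :: "'r code \<Rightarrow> 'r \<Rightarrow> nat list \<Rightarrow> bool" where
  "rel A = snd A"

definition structures :: "('r \<Rightarrow> nat) \<Rightarrow> 'r code set" where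
  "structures ar =
     {A. \<forall>r xs. rel A r xs \<longrightarrow> length xs = ar r \<and> set xs \<subseteq> universe A}"

text \<open>
  Maps between structures are normalised to be \<^const>\<open>undefined\<close> outside their domain, so that
  every such map has exactly one code in \<^typ>\<open>nat \<Rightarrow> nat\<close>.
\<close>

definition embedding :: "'r code \<Rightarrow> 'r code \<Rightarrow> (nat \<Rightarrow> nat) \<Rightarrow> bool" where
  "embedding A B f \<longleftrightarrow>
     f \<in> universe A \<rightarrow>\<^sub>E universe B \<and> inj_on f (universe A) \<and>
     (\<forall>r xs. set xs \<subseteq> universe A \<longrightarrow> rel B r (map f xs) = rel A r xs)"

definition Iso :: "'r code \<Rightarrow> 'r code \<Rightarrow> (nat \<Rightarrow> nat) set" where
  "Iso A B = {f. embedding A B f \<and> f ` universe A = universe B}"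

definition Aut :: "'r code \<Rightarrow> (nat \<Rightarrow> nat) set" where
  "Aut A = Iso A A"

definition structure_class :: "('r::countable \<Rightarrow> nat) \<Rightarrow> 'r code set \<Rightarrow> bool" where
  "structure_class ar K \<longleftrightarrow>
     K \<subseteq> structures ar \<and> K \<in> sets borel \<and>
     (\<forall>A\<in>K. \<forall>B\<in>structures ar. Iso A B \<noteq> {} \<longrightarrow> B \<in> K)"


section \<open>Quantifier-free types in one variable\<close>

datatype qf_term = Var | Param nat

datatype 'r qf_formula =
    Eq qf_term qf_term
  | Rel 'r "qf_term list"
  | Neg "'r qf_formula"
  | Conj "'r qf_formula" "'r qf_formula"

primrec term_over :: "nat set \<Rightarrow> qf_term \<Rightarrow> bool" where
  "term_over F Var = True"
| "term_over F (Param a) = (a \<in> F)"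

primrec formula_over :: "('r \<Rightarrow> nat) \<Rightarrow> nat set \<Rightarrow> 'r qf_formula \<Rightarrow> bool" where
  "formula_over ar F (Eq s t) = (term_over F s \<and> term_over F t)"
| "formula_over ar F (Rel r ts) = (length ts = ar r \<and> (\<forall>t\<in>set ts. term_over F t))"
| "formula_over ar F (Neg p) = formula_over ar F p"
| "formula_over ar F (Conj p q) = (formula_over ar F p \<and> formula_over ar F q)"

text \<open>In the following, \<open>v\<close> interprets the parameters and \<open>b\<close> is the value of the free variable.\<close>

primrec term_value :: "(nat \<Rightarrow> nat) \<Rightarrow> nat \<Rightarrow> qf_term \<Rightarrow> nat" where
  "term_value v b Var = b"
| "term_value v b (Param a) = v a"

primrec holds :: "'r code \<Rightarrow> (nat \<Rightarrow> nat) \<Rightarrow> nat \<Rightarrow> 'r qf_formula \<Rightarrow> bool" where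
  "holds B v b (Eq s t) = (term_value v b s = term_value v b t)"
| "holds B v b (Rel r ts) = rel B r (map (term_value v b) ts)"
| "holds B v b (Neg p) = (\<not> holds B v b p)"
| "holds B v b (Conj p q) = (holds B v b p \<and> holds B v b q)"

text \<open>
  The type \<open>\<tau>\<close> over \<open>A\<close> is realised in \<open>B\<close>, which extends \<open>A\<close> by way of the embedding \<open>j\<close>.
\<close>

definition realized_in :: "'r code \<Rightarrow> (nat \<Rightarrow> nat) \<Rightarrow> 'r qf_formula set \<Rightarrow> bool" where
  "realized_in B j \<tau> \<longleftrightarrow> (\<exists>b\<in>universe B. \<forall>p\<in>\<tau>. holds B j b p)"

definition finite_type_over :: "('r \<Rightarrow> nat) \<Rightarrow> 'r code \<Rightarrow> 'r qf_formula set \<Rightarrow> bool" where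
  "finite_type_over ar A \<tau> \<longleftrightarrow>
     (\<exists>F. finite F \<and> F \<subseteq> universe A \<and> (\<forall>p\<in>\<tau>. formula_over ar F p))"

definition admissible_type ::
    "('r \<Rightarrow> nat) \<Rightarrow> 'r code set \<Rightarrow> 'r code \<Rightarrow> 'r qf_formula set \<Rightarrow> bool" where
  "admissible_type ar K A \<tau> \<longleftrightarrow>
     finite_type_over ar A \<tau> \<and> (\<exists>B\<in>K. \<exists>j. embedding A B j \<and> realized_in B j \<tau>)"


section \<open>The automorphic Borel amalgamation property\<close>

text \<open>
  A code whose universe is all of the natural numbers has no proper superset to live on, so
  the extension of \<open>A\<close> is a structure \<open>E A\<close> together with an embedding \<open>e A\<close> of \<open>A\<close> into it,
  and the copy of \<open>A\<close> inside \<open>E A\<close> is \<open>e A ` universe A\<close>. The embedding is part of the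
  data of the extension, and like \<open>E\<close> it has to depend on \<open>A\<close> in a Borel way.  The map written
  with a tilde is \<open>til\<close>, the one written with a hat is \<open>hat\<close>.
\<close>

definition automorphism_pairs :: "'r code set \<Rightarrow> ('r code \<times> (nat \<Rightarrow> nat)) set" where
  "automorphism_pairs K = {(A, \<phi>). A \<in> K \<and> \<phi> \<in> Aut A}"

definition ABAP :: "('r::countable \<Rightarrow> nat) \<Rightarrow> 'r code set \<Rightarrow> bool" where
  "ABAP ar K \<longleftrightarrow>
    (\<exists>(E :: 'r code \<Rightarrow> 'r code) (e :: 'r code \<Rightarrow> nat \<Rightarrow> nat)
      (til :: 'r code \<times> (nat \<Rightarrow> nat) \<Rightarrow> nat \<Rightarrow> nat)
      (hat :: 'r code \<Rightarrow> 'r code \<Rightarrow> (nat \<Rightarrow> nat) \<Rightarrow> nat \<Rightarrow> nat).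
      E \<in> restrict_space borel K \<rightarrow>\<^sub>M restrict_space borel K \<and>
      e \<in> restrict_space borel K \<rightarrow>\<^sub>M borel \<and>
      (\<forall>A\<in>K. E A \<in> K \<and> embedding A (E A) (e A) \<and>
         (\<forall>\<tau>. admissible_type ar K A \<tau> \<longrightarrow> realized_in (E A) (e A) \<tau>)) \<and>
      til \<in> restrict_space borel (automorphism_pairs K) \<rightarrow>\<^sub>M borel \<and>
      (\<forall>A\<in>K. \<forall>\<phi>\<in>Aut A.
         til (A, \<phi>) \<in> Aut (E A) \<and>
         (\<forall>x\<in>universe A. til (A, \<phi>) (e A x) = e A (\<phi> x)) \<and>
         (\<forall>y\<in>universe (E A) - e A ` universe A. til (A, \<phi>) y \<noteq> y)) \<and>
      (\<forall>A0\<in>K. \<forall>A1\<in>K. \<forall>\<alpha>\<in>Iso A0 A1.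
         hat A0 A1 \<alpha> \<in> Iso (E A0) (E A1) \<and>
         (\<forall>x\<in>universe A0. hat A0 A1 \<alpha> (e A0 x) = e A1 (\<alpha> x)) \<and>
         (\<forall>\<phi>0\<in>Aut A0. \<forall>\<phi>1\<in>Aut A1.
            (\<forall>x\<in>universe A0. \<alpha> (\<phi>0 x) = \<phi>1 (\<alpha> x)) \<longrightarrow>
            (\<forall>y\<in>universe (E A0).
               hat A0 A1 \<alpha> (til (A0, \<phi>0) y) = til (A1, \<phi>1) (hat A0 A1 \<alpha> y)))))"


section \<open>Local orders\<close>

definition tournament_on :: "'a set \<Rightarrow> ('a \<Rightarrow> 'a \<Rightarrow> bool) \<Rightarrow> bool" where
  "tournament_on V R \<longleftrightarrow>
     irreflp_on V R \<and> (\<forall>x\<in>V. \<forall>y\<in>V. x \<noteq> y \<longrightarrow> (R x y \<longleftrightarrow> \<not> R y x))"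

definition strictly_linearly_ordered_by :: "'a set \<Rightarrow> ('a \<Rightarrow> 'a \<Rightarrow> bool) \<Rightarrow> bool" where
  "strictly_linearly_ordered_by V R \<longleftrightarrow> irreflp_on V R \<and> transp_on V R \<and> totalp_on V R"

definition local_order_on :: "'a set \<Rightarrow> ('a \<Rightarrow> 'a \<Rightarrow> bool) \<Rightarrow> bool" where
  "local_order_on V R \<longleftrightarrow> tournament_on V R \<and>
     (\<forall>x\<in>V. strictly_linearly_ordered_by {y\<in>V. R y x} R \<and>
             strictly_linearly_ordered_by {y\<in>V. R x y} R)"

text \<open>The language of local orders has a single relation symbol, which is binary.\<close>

abbreviation arrow_arity :: "unit \<Rightarrow> nat" where
  "arrow_arity \<equiv> (\<lambda>_. 2)"

definition arrow :: "unit code \<Rightarrow> nat \<Rightarrow> nat \<Rightarrow> bool" where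
  "arrow A x y = rel A () [x, y]"

definition countable_local_orders :: "unit code set" where
  "countable_local_orders =
     {A \<in> structures arrow_arity. local_order_on (universe A) (arrow A)}"

lemma local_order_on_iff:
  "local_order_on V R \<longleftrightarrow>
     (\<forall>x\<in>V. \<not> R x x) \<and>
     (\<forall>x\<in>V. \<forall>y\<in>V. x \<noteq> y \<longrightarrow> (R x y \<longleftrightarrow> \<not> R y x)) \<and>
     (\<forall>x\<in>V. \<forall>y\<in>V. \<forall>z\<in>V. \<forall>w\<in>V. R y z \<longrightarrow> R z w \<longrightarrow>
        (R y x \<and> R z x \<and> R w x \<or> R x y \<and> R x z \<and> R x w) \<longrightarrow> R y w)"
  (is "?L \<longleftrightarrow> ?R")
proof
  assume L: ?L
  then have t: "tournament_on V R" by (simp add: local_order_on_def)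
  have r: "R y w" if "x \<in> V" "y \<in> V" "z \<in> V" "w \<in> V" "R y z" "R z w"
    "R y x \<and> R z x \<and> R w x \<or> R x y \<and> R x z \<and> R x w" for x y z w
  proof -
    have "transp_on {u\<in>V. R u x} R" "transp_on {u\<in>V. R x u} R"
      using L \<open>x \<in> V\<close>
      by (auto simp: local_order_on_def strictly_linearly_ordered_by_def)
    then show ?thesis
      using that unfolding transp_on_def by blast
  qed
  show ?R
    by (intro conjI t[unfolded tournament_on_def irreflp_on_def, THEN conjunct1]
        t[unfolded tournament_on_def, THEN conjunct2] ballI impI) (rule r)
next
  assume R: ?R
  have t: "tournament_on V R"
    unfolding tournament_on_def irreflp_on_def
    by (intro conjI R[THEN conjunct1] R[THEN conjunct2, THEN conjunct1])
  have irr: "irreflp_on S R" if "S \<subseteq> V" for S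
    using R[THEN conjunct1] that unfolding irreflp_on_def by blast
  have tot: "totalp_on S R" if "S \<subseteq> V" for S
  proof (rule totalp_onI)
    fix x y assume "x \<in> S" "y \<in> S" "x \<noteq> y"
    with that have "R x y \<longleftrightarrow> \<not> R y x"
      by (intro R[THEN conjunct2, THEN conjunct1, rule_format]) auto
    then show "R x y \<or> R y x" by blast
  qed
  note r = R[THEN conjunct2, THEN conjunct2, rule_format]
  have "transp_on {u\<in>V. R u x} R" if "x \<in> V" for x
  proof (rule transp_onI)
    fix a b c assume "a \<in> {u\<in>V. R u x}" "b \<in> {u\<in>V. R u x}" "c \<in> {u\<in>V. R u x}" "R a b" "R b c"
    then show "R a c" by (intro r[OF that, of a b c]) blast+
  qed
  moreover have "transp_on {u\<in>V. R x u} R" if "x \<in> V" for x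
  proof (rule transp_onI)
    fix a b c assume "a \<in> {u\<in>V. R x u}" "b \<in> {u\<in>V. R x u}" "c \<in> {u\<in>V. R x u}" "R a b" "R b c"
    then show "R a c" by (intro r[OF that, of a b c]) blast+
  qed
  ultimately show ?L
    by (simp add: local_order_on_def strictly_linearly_ordered_by_def t irr tot)
qed

lemma borel_universe: "{A :: 'r code. n \<in> universe A} \<in> sets borel"
proof -
  have "continuous_on UNIV (\<lambda>A :: 'r code. fst A n)"
    by (rule continuous_on_product_then_coordinatewise[OF continuous_on_fst[OF continuous_on_id]])
  then have "open ((\<lambda>A :: 'r code. fst A n) -` {True})"
    by (rule open_vimage[OF open_discrete])
  then show ?thesis
    by (simp add: universe_def vimage_def)
qed

lemma borel_rel: "{A :: 'r code. rel A r xs} \<in> sets borel"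
proof -
  have "continuous_on UNIV (\<lambda>A :: 'r code. snd A r xs)"
    by (rule continuous_on_product_then_coordinatewise[OF
          continuous_on_product_then_coordinatewise[OF continuous_on_snd[OF continuous_on_id]]])
  then have "open ((\<lambda>A :: 'r code. snd A r xs) -` {True})"
    by (rule open_vimage[OF open_discrete])
  then show ?thesis
    by (simp add: rel_def vimage_def)
qed

lemma pred_universe [measurable]: "Measurable.pred borel (\<lambda>A :: 'r code. n \<in> universe A)"
  using borel_universe by (simp add: pred_def)

lemma pred_rel [measurable]: "Measurable.pred borel (\<lambda>A :: 'r code. rel A r xs)"
  using borel_rel by (simp add: pred_def)

lemma countable_local_orders_borel: "countable_local_orders \<in> sets borel"
proof -
  have eq: "countable_local_orders = {A.
      (\<forall>r xs. rel A r xs \<longrightarrow> length xs = 2 \<and> (\<forall>n\<in>set xs. n \<in> universe A)) \<and>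
      (\<forall>x. x \<in> universe A \<longrightarrow> \<not> rel A () [x, x]) \<and>
      (\<forall>x. x \<in> universe A \<longrightarrow> (\<forall>y. y \<in> universe A \<longrightarrow> x \<noteq> y \<longrightarrow>
         (rel A () [x, y] \<longleftrightarrow> \<not> rel A () [y, x]))) \<and>
      (\<forall>x. x \<in> universe A \<longrightarrow> (\<forall>y. y \<in> universe A \<longrightarrow>
         (\<forall>z. z \<in> universe A \<longrightarrow> (\<forall>w. w \<in> universe A \<longrightarrow>
         rel A () [y, z] \<longrightarrow> rel A () [z, w] \<longrightarrow>
         (rel A () [y, x] \<and> rel A () [z, x] \<and> rel A () [w, x]
          \<or> rel A () [x, y] \<and> rel A () [x, z] \<and> rel A () [x, w]) \<longrightarrow>
         rel A () [y, w]))))}" (is "_ = {A. ?P A}")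
    unfolding countable_local_orders_def structures_def local_order_on_iff arrow_def
      Ball_def subset_eq mem_Collect_eq by (rule refl)
  have "Measurable.pred borel ?P"
    by measurable
  then show ?thesis
    unfolding eq by (simp add: pred_def)
qed

lemma countable_local_orders_iso:
  assumes A: "A \<in> countable_local_orders" and B: "B \<in> structures arrow_arity"
    and f: "f \<in> Iso A B"
  shows "B \<in> countable_local_orders"
proof -
  have U: "universe B = f ` universe A"
    and R: "\<And>x y. x \<in> universe A \<Longrightarrow> y \<in> universe A \<Longrightarrow> arrow B (f x) (f y) = arrow A x y"
    and I: "\<And>x y. x \<in> universe A \<Longrightarrow> y \<in> universe A \<Longrightarrow> f x = f y \<longleftrightarrow> x = y"
  proof -
    show "universe B = f ` universe A" using f by (simp add: Iso_def)
    fix x y assume xy: "x \<in> universe A" "y \<in> universe A"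
    have e: "embedding A B f" using f by (simp add: Iso_def)
    then have "\<forall>r xs. set xs \<subseteq> universe A \<longrightarrow> rel B r (map f xs) = rel A r xs"
      by (simp add: embedding_def)
    from this[rule_format, of "[x, y]" "()"] xy
    show "arrow B (f x) (f y) = arrow A x y" by (simp add: arrow_def)
    show "f x = f y \<longleftrightarrow> x = y"
      using e xy by (auto simp: embedding_def inj_on_def)
  qed
  have "local_order_on (f ` universe A) (arrow B) \<longleftrightarrow> local_order_on (universe A) (arrow A)"
    unfolding local_order_on_iff by (simp only: ball_simps R I cong: ball_cong)
  with A have "local_order_on (f ` universe A) (arrow B)"
    by (simp only: countable_local_orders_def mem_Collect_eq)
  then show ?thesis
    using B U by (simp add: countable_local_orders_def)
qed

lemma structure_class_countable_local_orders:
  "structure_class arrow_arity countable_local_orders"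
  unfolding structure_class_def
  using countable_local_orders_borel countable_local_orders_iso
  by (auto simp: countable_local_orders_def)

end

theory Submission
  imports Defs
begin

text \<open>
  Place a local order on a circle so that \<open>x \<rightarrow> y\<close> means that \<open>y\<close> lies in the open half circle that
  starts at \<open>x\<close>.  Replacing a set of points by their antipodes (switching) again gives a local
  order, and so does blowing up each point to a linear order.  The extension \<open>E(A)\<close> adds, for every
  point \<open>a\<close>, a copy of \<open>\<int>\<close> just after \<open>a\<close> and a copy of \<open>\<int>\<close> just after the antipode of \<open>a\<close>.
  Relative to finitely many parameters, a new point \<open>b\<close> is determined by the last point before it
  among the parameters and their antipodes, so every admissible finite type is realized.  An
  isomorphism acts on the sites \<open>a\<close> alone, and the extension of an automorphism is moreover composed
  with a shift of the copies of \<open>\<int>\<close>, which removes fixed points and commutes with all these actions.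
\<close>

section \<open>Local orders: forbidden configurations, switching and blow-ups\<close>

lemma local_order_onD:
  assumes "local_order_on V R"
  shows local_order_on_irrefl: "x \<in> V \<Longrightarrow> \<not> R x x"
    and local_order_on_flip: "x \<in> V \<Longrightarrow> y \<in> V \<Longrightarrow> x \<noteq> y \<Longrightarrow> R x y \<longleftrightarrow> \<not> R y x"
proof -
  note D = assms[unfolded local_order_on_iff]
  show "x \<in> V \<Longrightarrow> \<not> R x x" using D[THEN conjunct1] by blast
  show "x \<in> V \<Longrightarrow> y \<in> V \<Longrightarrow> x \<noteq> y \<Longrightarrow> R x y \<longleftrightarrow> \<not> R y x"
    using D[THEN conjunct2, THEN conjunct1] by blast
qed

text \<open>In a tournament, transitivity can fail only through a directed 3-cycle. So the condition
  on predecessors and successors excludes exactly a 3-cycle together with a fourth vertex that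
  receives arrows from all of it or sends arrows to all of it. Closure properties can then be
  checked on four distinct points.\<close>

lemma local_order_on_alt:
  "local_order_on V R \<longleftrightarrow>
     (\<forall>x\<in>V. \<not> R x x) \<and>
     (\<forall>x\<in>V. \<forall>y\<in>V. x \<noteq> y \<longrightarrow> (R x y \<longleftrightarrow> \<not> R y x)) \<and>
     (\<forall>x\<in>V. \<forall>y\<in>V. \<forall>z\<in>V. \<forall>w\<in>V. distinct [x, y, z, w] \<longrightarrow> R y z \<longrightarrow> R z w \<longrightarrow> R w y \<longrightarrow>
        \<not> (R y x \<and> R z x \<and> R w x) \<and> \<not> (R x y \<and> R x z \<and> R x w))"
  (is "_ \<longleftrightarrow> ?I \<and> ?T \<and> ?C")
proof
  assume L: "local_order_on V R"
  note D = L[unfolded local_order_on_iff]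
  have IT: ?I ?T
    by (fact D[THEN conjunct1], fact D[THEN conjunct2, THEN conjunct1])
  note C = D[THEN conjunct2, THEN conjunct2, rule_format]
  have ?C
  proof (intro ballI impI)
    fix x y z w
    assume V: "x \<in> V" "y \<in> V" "z \<in> V" "w \<in> V" and d: "distinct [x, y, z, w]"
      and r: "R y z" "R z w" "R w y"
    have "\<not> R y w" using IT(2)[rule_format, OF V(2,4)] d r by auto
    then show "\<not> (R y x \<and> R z x \<and> R w x) \<and> \<not> (R x y \<and> R x z \<and> R x w)"
      using C[OF V r(1,2)] by blast
  qed
  with IT show "?I \<and> ?T \<and> ?C" by blast
next
  assume R: "?I \<and> ?T \<and> ?C"
  note IT = R[THEN conjunct1] R[THEN conjunct2, THEN conjunct1]
    and C = R[THEN conjunct2, THEN conjunct2]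
  have "R y w" if V: "x \<in> V" "y \<in> V" "z \<in> V" "w \<in> V" and r: "R y z" "R z w"
    and x: "R y x \<and> R z x \<and> R w x \<or> R x y \<and> R x z \<and> R x w" for x y z w
  proof (rule ccontr)
    assume n: "\<not> R y w"
    have "y \<noteq> w" using IT V r by metis
    then have wy: "R w y" using IT V n by metis
    have "distinct [x, y, z, w]" using IT V r x wy by auto
    then show False using C V r x wy by blast
  qed
  then show "local_order_on V R"
    unfolding local_order_on_iff by (intro conjI IT ballI impI)
qed

lemma local_order_on_cong:
  assumes "\<And>x y. x \<in> V \<Longrightarrow> y \<in> V \<Longrightarrow> R x y = R' x y"
  shows "local_order_on V R \<longleftrightarrow> local_order_on V R'"
  unfolding local_order_on_iff by (simp only: assms cong: ball_cong)

text \<open>The labelled tournaments on four points that consist of a 3-cycle and a source or a sink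
  form a family closed under switching, so a forbidden configuration after switching comes from one
  before it.\<close>

lemma local_order_on_switch:
  assumes L: "local_order_on V R"
  shows "local_order_on V (\<lambda>x y. R x y \<longleftrightarrow> (S x \<longleftrightarrow> S y))"
proof -
  note D = L[unfolded local_order_on_alt]
  note I = D[THEN conjunct1, rule_format]
    and T = D[THEN conjunct2, THEN conjunct1, rule_format]
    and C = D[THEN conjunct2, THEN conjunct2, rule_format]
  show ?thesis
    unfolding local_order_on_alt
  proof (intro conjI)
    show "\<forall>x\<in>V. \<not> (R x x \<longleftrightarrow> (S x \<longleftrightarrow> S x))" using I by simp
    show "\<forall>x\<in>V. \<forall>y\<in>V. x \<noteq> y \<longrightarrow> ((R x y \<longleftrightarrow> (S x \<longleftrightarrow> S y)) \<longleftrightarrow> \<not> (R y x \<longleftrightarrow> (S y \<longleftrightarrow> S x)))"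
      using T by blast
    show "\<forall>x\<in>V. \<forall>y\<in>V. \<forall>z\<in>V. \<forall>w\<in>V. distinct [x, y, z, w] \<longrightarrow>
       (R y z \<longleftrightarrow> (S y \<longleftrightarrow> S z)) \<longrightarrow> (R z w \<longleftrightarrow> (S z \<longleftrightarrow> S w)) \<longrightarrow> (R w y \<longleftrightarrow> (S w \<longleftrightarrow> S y)) \<longrightarrow>
       \<not> ((R y x \<longleftrightarrow> (S y \<longleftrightarrow> S x)) \<and> (R z x \<longleftrightarrow> (S z \<longleftrightarrow> S x)) \<and> (R w x \<longleftrightarrow> (S w \<longleftrightarrow> S x))) \<and>
       \<not> ((R x y \<longleftrightarrow> (S x \<longleftrightarrow> S y)) \<and> (R x z \<longleftrightarrow> (S x \<longleftrightarrow> S z)) \<and> (R x w \<longleftrightarrow> (S x \<longleftrightarrow> S w)))"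
    proof (intro ballI impI)
      fix x y z w
      assume V: "x \<in> V" "y \<in> V" "z \<in> V" "w \<in> V" and d: "distinct [x, y, z, w]"
        and r: "R y z \<longleftrightarrow> (S y \<longleftrightarrow> S z)" "R z w \<longleftrightarrow> (S z \<longleftrightarrow> S w)" "R w y \<longleftrightarrow> (S w \<longleftrightarrow> S y)"
      have T': "R x y \<longleftrightarrow> \<not> R y x" "R x z \<longleftrightarrow> \<not> R z x" "R x w \<longleftrightarrow> \<not> R w x"
          "R y z \<longleftrightarrow> \<not> R z y" "R z w \<longleftrightarrow> \<not> R w z" "R w y \<longleftrightarrow> \<not> R y w"
        by (rule T; use V d in auto)+
      have C': "\<not> (R b c \<and> R c d \<and> R d b \<and> (R b a \<and> R c a \<and> R d a \<or> R a b \<and> R a c \<and> R a d))"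
        if "distinct [a, b, c, d]" "{a, b, c, d} \<subseteq> V" for a b c d
        using C[of a b c d] that by blast
      \<comment> \<open>Four choices of the apex, two orientations of the cycle, and the apex as
        source or sink: these are all sixteen forbidden labelled tournaments. Each pattern of values
        of \<open>S\<close> leads back to one of them.\<close>
      have "\<not> (R y z \<and> R z w \<and> R w y \<and> (R y x \<and> R z x \<and> R w x \<or> R x y \<and> R x z \<and> R x w))"
       "\<not> (R y w \<and> R w z \<and> R z y \<and> (R y x \<and> R w x \<and> R z x \<or> R x y \<and> R x w \<and> R x z))"
       "\<not> (R x z \<and> R z w \<and> R w x \<and> (R x y \<and> R z y \<and> R w y \<or> R y x \<and> R y z \<and> R y w))"
       "\<not> (R x w \<and> R w z \<and> R z x \<and> (R x y \<and> R w y \<and> R z y \<or> R y x \<and> R y w \<and> R y z))"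
       "\<not> (R x y \<and> R y w \<and> R w x \<and> (R x z \<and> R y z \<and> R w z \<or> R z x \<and> R z y \<and> R z w))"
       "\<not> (R x w \<and> R w y \<and> R y x \<and> (R x z \<and> R w z \<and> R y z \<or> R z x \<and> R z w \<and> R z y))"
       "\<not> (R x y \<and> R y z \<and> R z x \<and> (R x w \<and> R y w \<and> R z w \<or> R w x \<and> R w y \<and> R w z))"
       "\<not> (R x z \<and> R z y \<and> R y x \<and> (R x w \<and> R z w \<and> R y w \<or> R w x \<and> R w z \<and> R w y))"
        by (rule C'; use V d in auto)+
      with T' r show "\<not> ((R y x \<longleftrightarrow> (S y \<longleftrightarrow> S x)) \<and> (R z x \<longleftrightarrow> (S z \<longleftrightarrow> S x)) \<and> (R w x \<longleftrightarrow> (S w \<longleftrightarrow> S x))) \<and>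
       \<not> ((R x y \<longleftrightarrow> (S x \<longleftrightarrow> S y)) \<and> (R x z \<longleftrightarrow> (S x \<longleftrightarrow> S z)) \<and> (R x w \<longleftrightarrow> (S x \<longleftrightarrow> S w)))"
        by (cases "S x"; cases "S y"; cases "S z"; cases "S w"; simp only: simp_thms; blast)
    qed
  qed
qed

text \<open>The fibres of \<open>f\<close> are blocks. A block is linear and its points look alike
  from outside, so the four points of a forbidden configuration lie in different blocks and project
  to a forbidden configuration in \<open>V\<close>.\<close>

lemma local_order_on_lex:
  fixes f :: "'a \<Rightarrow> 'b" and g :: "'a \<Rightarrow> 'c"
  assumes L: "local_order_on V R" and f: "f ` X \<subseteq> V"
    and inj: "inj_on (\<lambda>x. (f x, g x)) X"
    and Q: "strictly_linearly_ordered_by UNIV Q"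
  shows "local_order_on X (\<lambda>x y. if f x = f y then Q (g x) (g y) else R (f x) (f y))"
    (is "local_order_on X ?M")
proof -
  define M where "M = ?M"
  note D = L[unfolded local_order_on_alt]
  note T = D[THEN conjunct2, THEN conjunct1, rule_format]
    and C = D[THEN conjunct2, THEN conjunct2, rule_format]
  have qi: "\<not> Q s s" and qt: "Q s t \<Longrightarrow> Q t u \<Longrightarrow> Q s u" and qa: "s \<noteq> t \<Longrightarrow> Q s t \<or> Q t s" for s t u
    using Q unfolding strictly_linearly_ordered_by_def
    by (auto dest: irreflp_onD transp_onD totalp_onD)
  have qf: "Q s t \<longleftrightarrow> \<not> Q t s" if "s \<noteq> t" for s t using qi qt qa that by blast
  have fV: "f x \<in> V" if "x \<in> X" for x using f that by blast
  have g: "g x \<noteq> g y" if "x \<in> X" "y \<in> X" "x \<noteq> y" "f x = f y" for x y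
    using inj that unfolding inj_on_def by blast
  have eqM: "M x y \<longleftrightarrow> Q (g x) (g y)" if "f x = f y" for x y using that by (simp add: M_def)
  have neM: "M x y \<longleftrightarrow> R (f x) (f y)" if "f x \<noteq> f y" for x y using that by (simp add: M_def)
  have TM: "M x y \<longleftrightarrow> \<not> M y x" if "x \<in> X" "y \<in> X" "x \<noteq> y" for x y
  proof (cases "f x = f y")
    case True
    with qf[OF g[OF that True]] show ?thesis by (simp add: eqM)
  next
    case False
    with T[OF fV[OF that(1)] fV[OF that(2)] False] show ?thesis by (simp add: neM)
  qed
  \<comment> \<open>If two vertices of a 3-cycle shared a block, the third would lie in it too,
    against linearity of \<open>Q\<close>, or it would have the same relation to both.\<close>
  have cyc: "f p \<noteq> f q"
    if X: "p \<in> X" "q \<in> X" "r \<in> X" and r: "M p q" "M q r" "M r p" for p q r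
  proof
    assume e: "f p = f q"
    show False
    proof (cases "f q = f r")
      case True
      then have "Q (g p) (g q)" "Q (g q) (g r)" "Q (g r) (g p)" using e r eqM by auto
      then show False using qi qt by blast
    next
      case False
      then have "R (f q) (f r)" "R (f r) (f q)" using e r neM by auto
      then show False using T[OF fV[OF X(2)] fV[OF X(3)] False] by blast
    qed
  qed
  \<comment> \<open>A point \<open>x\<close> in the block of \<open>p\<close> would behave towards
    \<open>q\<close> and \<open>r\<close> as \<open>p\<close> does, hence send an arrow to
    \<open>q\<close> and receive one from \<open>r\<close>. A vertex that dominates the whole cycle,
    or is dominated by it, violates this.\<close>
  have apart: "f x \<noteq> f p"
    if X: "p \<in> X" "q \<in> X" "r \<in> X" and r: "M p q" "M q r" "M r p"
      and x: "M q x \<or> M x r" for x p q r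
  proof
    assume e: "f x = f p"
    have pq: "f p \<noteq> f q" "f r \<noteq> f p" using cyc[OF X r] cyc[OF X(3,1,2) r(3,1,2)] by auto
    then have "M q p \<or> M p r" using e x by (simp add: neM)
    moreover have "p \<noteq> q" "r \<noteq> p" using pq by auto
    ultimately show False using TM[of p q] TM[of r p] X r by blast
  qed
  have "local_order_on X M"
    unfolding local_order_on_alt
  proof (intro conjI ballI impI notI)
    fix x
    assume "M x x"
    then show False using qi by (simp add: eqM)
  next
    fix x y
    assume "x \<in> X" "y \<in> X" "x \<noteq> y"
    then show "M x y \<longleftrightarrow> \<not> M y x" by (rule TM)
  next
    fix x y z w
    assume X: "x \<in> X" "y \<in> X" "z \<in> X" "w \<in> X" and r: "M y z" "M z w" "M w y"
      and x: "M y x \<and> M z x \<and> M w x"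
    have d: "f y \<noteq> f z" "f z \<noteq> f w" "f w \<noteq> f y" "f x \<noteq> f y" "f x \<noteq> f z" "f x \<noteq> f w"
      using cyc[OF X(2,3,4) r] cyc[OF X(3,4,2) r(2,3,1)] cyc[OF X(4,2,3) r(3,1,2)]
        apart[OF X(2,3,4) r, of x] apart[OF X(3,4,2) r(2,3,1), of x] apart[OF X(4,2,3) r(3,1,2), of x]
        x by blast+
    then show False
      using C[OF fV[OF X(1)] fV[OF X(2)] fV[OF X(3)] fV[OF X(4)]] r x d[THEN not_sym]
      by (simp add: neM)
  next
    fix x y z w
    assume X: "x \<in> X" "y \<in> X" "z \<in> X" "w \<in> X" and r: "M y z" "M z w" "M w y"
      and x: "M x y \<and> M x z \<and> M x w"
    have d: "f y \<noteq> f z" "f z \<noteq> f w" "f w \<noteq> f y" "f x \<noteq> f y" "f x \<noteq> f z" "f x \<noteq> f w"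
      using cyc[OF X(2,3,4) r] cyc[OF X(3,4,2) r(2,3,1)] cyc[OF X(4,2,3) r(3,1,2)]
        apart[OF X(2,3,4) r, of x] apart[OF X(3,4,2) r(2,3,1), of x] apart[OF X(4,2,3) r(3,1,2), of x]
        x by blast+
    then show False
      using C[OF fV[OF X(1)] fV[OF X(2)] fV[OF X(3)] fV[OF X(4)]] r x d[THEN not_sym]
      by (simp add: neM)
  qed
  then show ?thesis by (simp add: M_def)
qed

text \<open>On the circle, take the last point before \<open>b\<close> among \<open>F\<close> and
  the antipodes of \<open>F\<close>, and let \<open>a\<close> be the element of \<open>F\<close> it
  comes from. If \<open>R a b\<close>, this point is \<open>a\<close>, and the other elements of
  \<open>F\<close> relate to \<open>b\<close> as to \<open>a\<close>; otherwise it is the antipode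
  of \<open>a\<close>, and these relations are reversed.\<close>

lemma local_order_finite_nearest:
  assumes L: "local_order_on V R" and F: "finite F" "F \<noteq> {}" "F \<subseteq> V" and b: "b \<in> V" "b \<notin> F"
  obtains a where "a \<in> F" "\<And>c. c \<in> F \<Longrightarrow> c \<noteq> a \<Longrightarrow> R c b \<longleftrightarrow> (R c a \<longleftrightarrow> R a b)"
proof -
  \<comment> \<open>Switching the successors of \<open>b\<close> makes all of \<open>F\<close> precede \<open>b\<close>, hence linearly ordered.\<close>
  define Q where "Q = (\<lambda>x y. R x y \<longleftrightarrow> (R b x \<longleftrightarrow> R b y))"
  have LQ: "local_order_on V Q"
    unfolding Q_def by (rule local_order_on_switch[OF L])
  have bF: "R b c \<longleftrightarrow> \<not> R c b" if "c \<in> F" for c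
    using local_order_on_flip[OF L b(1), of c] F(3) b(2) that by blast
  have "Q c b" if "c \<in> F" for c
    using bF[OF that] local_order_on_irrefl[OF L b(1)] by (auto simp: Q_def)
  then have "strictly_linearly_ordered_by {y\<in>V. Q y b} Q" and sub: "F \<subseteq> {y\<in>V. Q y b}"
    using LQ b F unfolding local_order_on_def by auto
  then have Qt: "transp_on F Q" "asymp_on F Q" and tot: "totalp_on F Q"
    unfolding strictly_linearly_ordered_by_def
    using asymp_on_iff_irreflp_on_if_transp_on
    by (blast intro: transp_on_subset totalp_on_subset asymp_on_subset)+
  have Qi: "\<not> Q c c" if "c \<in> F" for c
    using local_order_on_irrefl[OF LQ] F that by blast
  obtain a where a: "a \<in> F" "\<And>c. c \<in> F \<Longrightarrow> \<not> Q a c"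
    using Finite_Set.bex_max_element[OF F(1) Qt(2,1) F(2)] Qi by metis
  show thesis
  proof
    fix c assume c: "c \<in> F" "c \<noteq> a"
    \<comment> \<open>All other elements of \<open>F\<close> lie below the maximum; undoing the
      switch in \<open>Q c a\<close> gives the claimed equivalence.\<close>
    then have "Q c a" using tot a unfolding totalp_on_def by blast
    then show "R c b \<longleftrightarrow> (R c a \<longleftrightarrow> R a b)"
      using bF[OF c(1)] bF[OF a(1)] by (auto simp: Q_def)
  qed (fact a)
qed

section \<open>The extension and its coding\<close>

text \<open>
  A point of the extension is coded as a pair of a site, which is a point of \<open>A\<close>, and a tier.  Tier
  \<open>0\<close> is the site itself; the tier coding an integer \<open>i\<close> is just after the site if \<open>i\<close> is even, and
  just after its antipode if \<open>i\<close> is odd.  As the two copies are interleaved, no two points of the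
  extension are antipodal.
\<close>

definition site :: "nat \<Rightarrow> nat" where
  "site y = fst (prod_decode y)"

definition tier :: "nat \<Rightarrow> nat" where
  "tier y = snd (prod_decode y)"

definition tier_less :: "nat \<Rightarrow> nat \<Rightarrow> bool" where
  "tier_less s t \<longleftrightarrow> t \<noteq> 0 \<and> (s = 0 \<or> int_decode (s - 1) < int_decode (t - 1))"

definition flipped :: "nat \<Rightarrow> bool" where
  "flipped t \<longleftrightarrow> t \<noteq> 0 \<and> odd (int_decode (t - 1))"

text \<open>Adding 2 keeps the parity, so points after a site are not exchanged with points after
  its antipode.\<close>

definition tier_shift :: "nat \<Rightarrow> nat" where
  "tier_shift t = (if t = 0 then 0 else Suc (int_encode (int_decode (t - 1) + 2)))"

text \<open>The empty local order gets a phantom site \<open>0\<close>, since its extension must be nonempty.\<close>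

definition base :: "unit code \<Rightarrow> nat set" where
  "base A = (if universe A = {} then {0} else universe A)"

definition ext_universe :: "unit code \<Rightarrow> nat set" where
  "ext_universe A = {y. site y \<in> base A \<and> (tier y = 0 \<longrightarrow> site y \<in> universe A)}"

text \<open>With each flipped point replaced by its antipode, every added point lies just after its
  site, and the conditional compares points lexicographically by site and tier. The outer
  equivalence switches the flipped points back.\<close>

definition ext_arrow :: "unit code \<Rightarrow> nat \<Rightarrow> nat \<Rightarrow> bool" where
  "ext_arrow A x y \<longleftrightarrow>
     ((if site x = site y then tier_less (tier x) (tier y) else arrow A (site x) (site y))
      \<longleftrightarrow> (flipped (tier x) \<longleftrightarrow> flipped (tier y)))"

definition ext :: "unit code \<Rightarrow> unit code" where
  "ext A = (\<lambda>y. y \<in> ext_universe A,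
     \<lambda>r xs. length xs = 2 \<and> set xs \<subseteq> ext_universe A \<and> ext_arrow A (xs ! 0) (xs ! 1))"

definition inc :: "unit code \<Rightarrow> nat \<Rightarrow> nat" where
  "inc A = restrict (\<lambda>n. prod_encode (n, 0)) (universe A)"

text \<open>The second branch is there for the phantom site.\<close>

definition site_map :: "unit code \<Rightarrow> (nat \<Rightarrow> nat) \<Rightarrow> nat \<Rightarrow> nat" where
  "site_map A \<alpha> a = (if a \<in> universe A then \<alpha> a else a)"

text \<open>Sites and tiers move independently. With \<sigma> = \<open>tier_shift\<close> this
  extends an automorphism as the tilde map, with \<sigma> = \<open>id\<close> it is the hat of an
  isomorphism; on tiers the two commute.\<close>

definition lift :: "(nat \<Rightarrow> nat) \<Rightarrow> unit code \<Rightarrow> (nat \<Rightarrow> nat) \<Rightarrow> nat \<Rightarrow> nat" where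
  "lift \<sigma> A \<alpha> = restrict (\<lambda>y. prod_encode (site_map A \<alpha> (site y), \<sigma> (tier y))) (ext_universe A)"

lemma site_tier_simps [simp]:
  "site (prod_encode (a, t)) = a" "tier (prod_encode (a, t)) = t"
  "prod_encode (site y, tier y) = y"
  by (simp_all add: site_def tier_def)

lemma site_tier_eqI: "site x = site y \<Longrightarrow> tier x = tier y \<Longrightarrow> x = y"
  by (metis site_tier_simps(3))

lemma tier_less_linear: "strictly_linearly_ordered_by UNIV tier_less"
proof -
  have "s = t" if "\<not> tier_less s t" "\<not> tier_less t s" for s t
    using that by (cases s; cases t) (auto simp: tier_less_def int_decode_eq not_less dest: antisym)
  then have "totalp_on UNIV tier_less" by (auto intro: totalp_onI)
  moreover have "irreflp_on UNIV tier_less" "transp_on UNIV tier_less"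
    by (auto simp: tier_less_def irreflp_on_def transp_on_def)
  ultimately show ?thesis by (simp add: strictly_linearly_ordered_by_def)
qed

lemma tier_shift_0 [simp]: "tier_shift t = 0 \<longleftrightarrow> t = 0"
  by (simp add: tier_shift_def)

lemma tier_shift_neq: "t \<noteq> 0 \<Longrightarrow> tier_shift t \<noteq> t"
  by (cases t) (auto simp: tier_shift_def dest: arg_cong[of _ _ int_decode])

lemma tier_less_shift: "tier_less (tier_shift s) (tier_shift t) \<longleftrightarrow> tier_less s t"
  by (simp add: tier_less_def) (simp add: tier_shift_def)

lemma flipped_shift: "flipped (tier_shift t) \<longleftrightarrow> flipped t"
  by (simp add: flipped_def) (simp add: tier_shift_def)

lemma bij_tier_shift: "bij tier_shift"
proof (rule o_bij)
  let ?h = "\<lambda>t. if t = 0 then 0 else Suc (int_encode (int_decode (t - 1) - 2))"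
  show "?h \<circ> tier_shift = id" "tier_shift \<circ> ?h = id"
    by (auto simp: fun_eq_iff tier_shift_def)
qed

lemma universe_ext [simp]: "universe (ext A) = ext_universe A"
  by (simp add: universe_def ext_def)

lemma arrow_ext: "x \<in> ext_universe A \<Longrightarrow> y \<in> ext_universe A \<Longrightarrow> arrow (ext A) x y = ext_arrow A x y"
  by (simp add: arrow_def rel_def ext_def)

lemma ext_structures: "ext A \<in> structures arrow_arity"
  unfolding structures_def by (simp add: rel_def) (simp add: ext_def)

lemma arrow_universe:
  assumes "A \<in> structures arrow_arity" "arrow A x y"
  shows "x \<in> universe A" "y \<in> universe A"
  using assms unfolding structures_def arrow_def by auto

lemma local_order_base:
  assumes "A \<in> countable_local_orders"
  shows "local_order_on (base A) (arrow A)"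
proof (cases "universe A = {}")
  case True
  \<comment> \<open>Relations of a structure are confined to its universe, so the phantom site
    carries no loop.\<close>
  then have "\<not> arrow A x y" for x y
    using assms arrow_universe(1)[of A x y] by (auto simp: countable_local_orders_def)
  with True show ?thesis
    by (auto simp: base_def local_order_on_iff)
next
  case False
  with assms show ?thesis by (simp add: base_def countable_local_orders_def)
qed

lemma ext_local_order:
  assumes "A \<in> countable_local_orders"
  shows "ext A \<in> countable_local_orders"
proof -
  have "local_order_on (ext_universe A)
      (\<lambda>x y. if site x = site y then tier_less (tier x) (tier y) else arrow A (site x) (site y))"
    by (rule local_order_on_lex[OF local_order_base[OF assms] _ _ tier_less_linear])
      (auto simp: ext_universe_def inj_on_def intro: site_tier_eqI)
  then have "local_order_on (ext_universe A) (ext_arrow A)"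
    unfolding ext_arrow_def by (rule local_order_on_switch)
  then have "local_order_on (ext_universe A) (arrow (ext A))"
    by (simp add: local_order_on_cong[OF arrow_ext])
  then show ?thesis
    by (simp add: countable_local_orders_def ext_structures)
qed

section \<open>Embeddings of binary structures and lifts of isomorphisms\<close>

lemma embedding_arrow:
  assumes "embedding A B f" "x \<in> universe A" "y \<in> universe A"
  shows "arrow B (f x) (f y) = arrow A x y"
proof -
  have "set [x, y] \<subseteq> universe A" using assms by simp
  then have "rel B () (map f [x, y]) = rel A () [x, y]"
    using assms(1) unfolding embedding_def by blast
  then show ?thesis by (simp add: arrow_def)
qed

text \<open>Lists of length other than 2 satisfy no relation in either structure, so only arrows
  have to be preserved.\<close>

lemma embedding_binary:
  assumes "A \<in> structures arrow_arity" "B \<in> structures arrow_arity"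
  shows "embedding A B f \<longleftrightarrow>
     f \<in> universe A \<rightarrow>\<^sub>E universe B \<and> inj_on f (universe A) \<and>
     (\<forall>x\<in>universe A. \<forall>y\<in>universe A. arrow B (f x) (f y) = arrow A x y)"
proof -
  have len: "length xs = 2" if "rel C r xs" "C = A \<or> C = B" for C r xs
    using assms that unfolding structures_def by auto
  have "rel B r (map f xs) = rel A r xs"
    if 1: "\<forall>x\<in>universe A. \<forall>y\<in>universe A. arrow B (f x) (f y) = arrow A x y"
      and 2: "set xs \<subseteq> universe A" for r xs
  proof (cases "length xs = 2")
    case True
    then obtain x y where "xs = [x, y]" by (auto simp: numeral_2_eq_2 length_Suc_conv)
    with 1 2 show ?thesis by (simp add: arrow_def)
  next
    case False
    then show ?thesis using len[of A r xs] len[of B r "map f xs"] by auto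
  qed
  then show ?thesis
    using embedding_arrow[of A B f] unfolding embedding_def by blast
qed

lemma inc_embedding:
  assumes "A \<in> countable_local_orders"
  shows "embedding A (ext A) (inc A)"
proof -
  have A: "A \<in> structures arrow_arity" "local_order_on (universe A) (arrow A)"
    using assms by (simp_all add: countable_local_orders_def)
  have U: "prod_encode (x, 0) \<in> ext_universe A" if "x \<in> universe A" for x
    using that by (auto simp: ext_universe_def base_def)
  show ?thesis
    unfolding embedding_binary[OF A(1) ext_structures]
  proof (intro conjI ballI)
    show "inc A \<in> universe A \<rightarrow>\<^sub>E universe (ext A)" using U by (auto simp: inc_def)
    show "inj_on (inc A) (universe A)" by (auto simp: inc_def inj_on_def)
    fix x y assume "x \<in> universe A" "y \<in> universe A"
    \<comment> \<open>For \<open>x = y\<close> the arrow in \<open>ext A\<close> is decided by the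
      tiers and is false, which agrees with irreflexivity of \<open>A\<close>. Otherwise both points
      are unflipped and the arrow is that of the sites.\<close>
    then show "arrow (ext A) (inc A x) (inc A y) = arrow A x y"
      using U local_order_on_irrefl[OF A(2)]
      by (auto simp: arrow_ext inc_def ext_arrow_def flipped_def tier_less_def)
  qed
qed

lemma inc_image: "inc A ` universe A = {y \<in> ext_universe A. tier y = 0}"
proof (intro equalityI subsetI)
  fix y assume "y \<in> {y \<in> ext_universe A. tier y = 0}"
  then have "y = inc A (site y)" "site y \<in> universe A"
    by (auto simp: ext_universe_def inc_def intro: site_tier_eqI)
  then show "y \<in> inc A ` universe A" by blast
qed (auto simp: inc_def ext_universe_def base_def)

text \<open>Only an empty order is isomorphic to an empty one, so the phantom site corresponds to
  the phantom site.\<close>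

lemma site_map_bij:
  assumes "\<alpha> \<in> Iso A B"
  shows "bij_betw (site_map A \<alpha>) (base A) (base B)"
    and "x \<in> base A \<Longrightarrow> site_map A \<alpha> x \<in> universe B \<longleftrightarrow> x \<in> universe A"
proof -
  have \<alpha>: "inj_on \<alpha> (universe A)" "\<alpha> ` universe A = universe B"
    using assms by (auto simp: Iso_def embedding_def)
  then show "bij_betw (site_map A \<alpha>) (base A) (base B)"
    unfolding bij_betw_def site_map_def base_def by (auto simp: inj_on_def)
  show "x \<in> base A \<Longrightarrow> site_map A \<alpha> x \<in> universe B \<longleftrightarrow> x \<in> universe A"
    using \<alpha> by (auto simp: base_def site_map_def split: if_splits)
qed

lemma site_map_arrow:
  assumes "\<alpha> \<in> Iso A B" "A \<in> structures arrow_arity" "B \<in> structures arrow_arity"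
    and "x \<in> base A" "y \<in> base A"
  shows "arrow B (site_map A \<alpha> x) (site_map A \<alpha> y) = arrow A x y"
proof (cases "universe A = {}")
  case True
  then have "universe B = {}" using assms(1) by (auto simp: Iso_def)
  with True show ?thesis using arrow_universe assms(2,3) by blast
next
  case False
  then show ?thesis
    using assms embedding_binary[OF assms(2,3), of \<alpha>] by (auto simp: base_def Iso_def site_map_def)
qed

text \<open>Arrows of the extension depend on the sites, the comparison of tiers and their flips,
  and all of these are preserved. The condition on tier 0 keeps the sites themselves apart from the
  added points.\<close>

lemma lift_Iso:
  assumes A: "A \<in> structures arrow_arity" and B: "B \<in> structures arrow_arity"
    and \<alpha>: "\<alpha> \<in> Iso A B" and \<sigma>: "bij \<sigma>"
    and \<sigma>0: "\<And>t. \<sigma> t = 0 \<longleftrightarrow> t = 0" and less: "\<And>s t. tier_less (\<sigma> s) (\<sigma> t) \<longleftrightarrow> tier_less s t"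
    and flip: "\<And>t. flipped (\<sigma> t) \<longleftrightarrow> flipped t"
  shows "lift \<sigma> A \<alpha> \<in> Iso (ext A) (ext B)"
proof -
  note bij = site_map_bij(1)[OF \<alpha>]
  have inj: "site_map A \<alpha> (site x) = site_map A \<alpha> (site y) \<longleftrightarrow> site x = site y"
    if "x \<in> ext_universe A" "y \<in> ext_universe A" for x y
    using bij that inj_on_eq_iff[of "site_map A \<alpha>" "base A"]
    by (simp add: bij_betw_def ext_universe_def)
  have \<sigma>inj: "\<sigma> s = \<sigma> t \<longleftrightarrow> s = t" for s t
    using \<sigma> by (simp add: bij_is_inj inj_eq)
  have into: "lift \<sigma> A \<alpha> x \<in> ext_universe B" if "x \<in> ext_universe A" for x
    using that bij site_map_bij(2)[OF \<alpha>, of "site x"]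
    by (auto simp: lift_def ext_universe_def \<sigma>0 bij_betw_def)
  have onto: "y \<in> lift \<sigma> A \<alpha> ` ext_universe A" if y: "y \<in> ext_universe B" for y
  proof -
    obtain a where a: "a \<in> base A" "site_map A \<alpha> a = site y"
      using bij_betw_imp_surj_on[OF bij] y unfolding ext_universe_def
      by (metis (mono_tags, lifting) image_iff mem_Collect_eq)
    obtain t where t: "\<sigma> t = tier y"
      using \<sigma> by (metis bij_pointE)
    have "prod_encode (a, t) \<in> ext_universe A"
      using a t y site_map_bij(2)[OF \<alpha> a(1)] \<sigma>0[of t] by (auto simp: ext_universe_def)
    moreover from this have "y = lift \<sigma> A \<alpha> (prod_encode (a, t))"
      using a t by (simp add: lift_def)
    ultimately show ?thesis by blast
  qed
  have "embedding (ext A) (ext B) (lift \<sigma> A \<alpha>)"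
    unfolding embedding_binary[OF ext_structures ext_structures] universe_ext
  proof (intro conjI ballI)
    show "lift \<sigma> A \<alpha> \<in> ext_universe A \<rightarrow>\<^sub>E ext_universe B"
      using into by (auto simp: lift_def)
    show "inj_on (lift \<sigma> A \<alpha>) (ext_universe A)"
      by (auto simp: inj_on_def lift_def inj \<sigma>inj intro: site_tier_eqI)
    fix x y assume xy: "x \<in> ext_universe A" "y \<in> ext_universe A"
    then have "site x \<in> base A" "site y \<in> base A" by (auto simp: ext_universe_def)
    from site_map_arrow[OF \<alpha> A B this]
    have "ext_arrow B (lift \<sigma> A \<alpha> x) (lift \<sigma> A \<alpha> y) = ext_arrow A x y"
      using xy by (simp add: ext_arrow_def lift_def inj less flip)
    then show "arrow (ext B) (lift \<sigma> A \<alpha> x) (lift \<sigma> A \<alpha> y) = arrow (ext A) x y"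
      using xy into by (simp add: arrow_ext)
  qed
  moreover have "lift \<sigma> A \<alpha> ` ext_universe A = ext_universe B"
    using into onto by blast
  ultimately show ?thesis by (simp add: Iso_def)
qed

lemma lift_inc:
  assumes "x \<in> universe A" "\<alpha> x \<in> universe B" "\<sigma> 0 = 0"
  shows "lift \<sigma> A \<alpha> (inc A x) = inc B (\<alpha> x)"
  using assms by (auto simp: lift_def inc_def ext_universe_def base_def site_map_def)

section \<open>Finite types in local orders and their realization\<close>

lemma holds_cong:
  assumes "\<And>s t. term_over F s \<Longrightarrow> term_over F t \<Longrightarrow>
      term_value v b s = term_value v b t \<longleftrightarrow> term_value w c s = term_value w c t"
    and "\<And>r ts. length ts = ar r \<Longrightarrow> \<forall>t\<in>set ts. term_over F t \<Longrightarrow>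
      rel B r (map (term_value v b) ts) = rel C r (map (term_value w c) ts)"
    and "formula_over ar F p"
  shows "holds B v b p \<longleftrightarrow> holds C w c p"
  using assms(3) by (induction p) (use assms(1,2) in auto)

text \<open>Parameters relate to each other as in \<open>A\<close>, there are no loops at
  \<open>b\<close> and \<open>c\<close>, and arrows leaving these points are determined by equality
  and by the arrows arriving there. So the two assumptions on \<open>b\<close> and \<open>c\<close>
  settle every atomic formula.\<close>

lemma holds_local_order_cong:
  assumes emb: "embedding A B j" "embedding A C k"
    and BC: "B \<in> countable_local_orders" "C \<in> countable_local_orders"
    and F: "F \<subseteq> universe A" and bc: "b \<in> universe B" "c \<in> universe C"
    and eq: "\<And>a. a \<in> F \<Longrightarrow> j a = b \<longleftrightarrow> k a = c"
    and arr: "\<And>a. a \<in> F \<Longrightarrow> arrow B (j a) b \<longleftrightarrow> arrow C (k a) c"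
    and p: "formula_over arrow_arity F p"
  shows "holds B j b p \<longleftrightarrow> holds C k c p"
proof -
  have LO: "local_order_on (universe B) (arrow B)" "local_order_on (universe C) (arrow C)"
    using BC by (simp_all add: countable_local_orders_def)
  have jk: "j a \<in> universe B" "k a \<in> universe C" if "a \<in> F" for a
    using emb F that unfolding embedding_def by (auto simp: PiE_iff)
  have jkeq: "j a = j a' \<longleftrightarrow> k a = k a'" if "a \<in> F" "a' \<in> F" for a a'
    using emb F that unfolding embedding_def by (metis inj_on_eq_iff subsetD)
  have jkarr: "arrow B (j a) (j a') \<longleftrightarrow> arrow C (k a) (k a')" if "a \<in> F" "a' \<in> F" for a a'
    using emb[THEN embedding_arrow, of a a'] F that by blast
  have irr: "\<not> arrow B b b" "\<not> arrow C c c"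
    using LO bc by (blast dest: local_order_on_irrefl)+
  have arr': "arrow B b (j a) \<longleftrightarrow> arrow C c (k a)" if "a \<in> F" for a
  proof (cases "j a = b")
    case True
    with eq[OF that] irr show ?thesis by simp
  next
    case False
    with eq[OF that] arr[OF that] show ?thesis
      using local_order_on_flip[OF LO(1) jk(1)[OF that] bc(1)]
        local_order_on_flip[OF LO(2) jk(2)[OF that] bc(2)] by simp
  qed
  have val: "term_value j b s = term_value j b t \<longleftrightarrow> term_value k c s = term_value k c t"
    if "term_over F s" "term_over F t" for s t
    using that eq jkeq by (cases s; cases t) (auto simp: eq_commute[of b] eq_commute[of c])
  have rel: "rel B r (map (term_value j b) ts) = rel C r (map (term_value k c) ts)"
    if len: "length ts = 2" and ts: "\<forall>t\<in>set ts. term_over F t" for r ts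
  proof -
    obtain s t where st: "ts = [s, t]" using len by (auto simp: numeral_2_eq_2 length_Suc_conv)
    have "arrow B (term_value j b s) (term_value j b t) \<longleftrightarrow>
        arrow C (term_value k c s) (term_value k c t)"
      using ts st arr arr' jkarr irr by (cases s; cases t) auto
    then show ?thesis using st by (simp add: arrow_def)
  qed
  show ?thesis using val rel p by (rule holds_cong)
qed

text \<open>A realization \<open>b\<close> in some larger local order is imitated by a point
  \<open>y\<close> of the extension. By \<open>holds_local_order_cong\<close> it is enough that
  \<open>y\<close> agrees with \<open>b\<close> on equalities with parameters and on arrows from
  them.\<close>

lemma ext_realizes:
  assumes A: "A \<in> countable_local_orders" and \<tau>: "admissible_type arrow_arity countable_local_orders A \<tau>"
  shows "realized_in (ext A) (inc A) \<tau>"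
proof -
  obtain F B j b where F: "finite F" "F \<subseteq> universe A" "\<And>p. p \<in> \<tau> \<Longrightarrow> formula_over arrow_arity F p"
    and B: "B \<in> countable_local_orders" and j: "embedding A B j"
    and b: "b \<in> universe B" "\<And>p. p \<in> \<tau> \<Longrightarrow> holds B j b p"
    using \<tau> unfolding admissible_type_def finite_type_over_def realized_in_def by blast
  have LB: "local_order_on (universe B) (arrow B)"
    using B by (simp add: countable_local_orders_def)
  have jB: "j a \<in> universe B" if "a \<in> universe A" for a
    using j that by (auto simp: embedding_def)
  have jarr: "arrow B (j a) (j c) \<longleftrightarrow> arrow A a c" if "a \<in> F" "c \<in> F" for a c
    using embedding_arrow[OF j] F(2) that by blast
  obtain y where y: "y \<in> ext_universe A" "\<And>a. a \<in> F \<Longrightarrow> j a = b \<longleftrightarrow> inc A a = y"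
    "\<And>a. a \<in> F \<Longrightarrow> arrow B (j a) b \<longleftrightarrow> arrow (ext A) (inc A a) y"
  proof (cases "b \<in> j ` F")
    case True
    then obtain a where a: "a \<in> F" "b = j a" by blast
    note e = inc_embedding[OF A]
    show ?thesis
    proof (rule that[of "inc A a"])
      show "inc A a \<in> ext_universe A" using e a F(2) by (auto simp: embedding_def)
      fix c assume c: "c \<in> F"
      show "j c = b \<longleftrightarrow> inc A c = inc A a"
        using a c F(2) e j unfolding embedding_def inj_on_def by blast
      have "arrow (ext A) (inc A c) (inc A a) \<longleftrightarrow> arrow A c a"
        using embedding_arrow[OF e] a c F(2) by blast
      then show "arrow B (j c) b \<longleftrightarrow> arrow (ext A) (inc A c) (inc A a)"
        using jarr a c by simp
    qed
  next
    case False
    show ?thesis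
    proof (cases "F = {}")
      case True
      \<comment> \<open>Without parameters any point will do. Thanks to the phantom site there is
        one even over the empty order.\<close>
      obtain a where "a \<in> base A" unfolding base_def by (cases "universe A = {}") auto
      then have "prod_encode (a, 1) \<in> ext_universe A" by (simp add: ext_universe_def)
      with True show ?thesis by (intro that) auto
    next
      case False
      \<comment> \<open>The nearest parameter is found among the images in \<open>B\<close> and
        pulled back along the injective \<open>j\<close>.\<close>
      obtain a where a: "a \<in> F"
        "\<And>c. c \<in> F \<Longrightarrow> c \<noteq> a \<Longrightarrow> arrow B (j c) b \<longleftrightarrow> (arrow B (j c) (j a) \<longleftrightarrow> arrow B (j a) b)"
      proof -
        obtain d where d: "d \<in> j ` F" "\<And>c. c \<in> j ` F \<Longrightarrow> c \<noteq> d \<Longrightarrow>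
            arrow B c b \<longleftrightarrow> (arrow B c d \<longleftrightarrow> arrow B d b)"
          using local_order_finite_nearest[OF LB, of "j ` F" b] F jB b(1) \<open>b \<notin> j ` F\<close> False by blast
        then obtain a where a: "a \<in> F" "d = j a" by blast
        have "j c \<noteq> j a" if "c \<in> F" "c \<noteq> a" for c
          using that a j F(2) unfolding embedding_def inj_on_def by blast
        then show thesis using that[of a] a d by blast
      qed
      \<comment> \<open>The integers 0 and 1 represent the two parities: the new point goes just
        after \<open>a\<close> if \<open>a\<close> precedes \<open>b\<close>, and just after the
        antipode of \<open>a\<close> otherwise.\<close>
      define t where "t = Suc (int_encode (if arrow B (j a) b then 0 else 1))"
      have t: "t \<noteq> 0" "flipped t \<longleftrightarrow> \<not> arrow B (j a) b" by (auto simp: t_def flipped_def)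
      show ?thesis
      proof (rule that[of "prod_encode (a, t)"])
        show y: "prod_encode (a, t) \<in> ext_universe A"
          using a(1) F(2) t by (auto simp: ext_universe_def base_def)
        fix c assume c: "c \<in> F"
        then have cA: "c \<in> universe A" using F(2) by blast
        show "j c = b \<longleftrightarrow> inc A c = prod_encode (a, t)"
          using cA c t \<open>b \<notin> j ` F\<close> by (auto simp: inc_def)
        \<comment> \<open>For \<open>c = a\<close> the tier comparison is true and the flip of
          \<open>t\<close> decides. For other \<open>c\<close> the flip keeps or reverses the arrow
          between \<open>c\<close> and \<open>a\<close>, as the choice of \<open>a\<close>
          prescribes.\<close>
        have "ext_arrow A (inc A c) (prod_encode (a, t)) \<longleftrightarrow> arrow B (j c) b"
          using a(2)[OF c] jarr[OF c a(1)] cA t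
          by (auto simp: ext_arrow_def inc_def tier_less_def flipped_def)
        moreover have "inc A c \<in> ext_universe A"
          using cA by (auto simp: inc_def ext_universe_def base_def)
        ultimately show "arrow B (j c) b \<longleftrightarrow> arrow (ext A) (inc A c) (prod_encode (a, t))"
          using y by (simp add: arrow_ext)
      qed
    qed
  qed
  have "holds (ext A) (inc A) y p" if "p \<in> \<tau>" for p
    using holds_local_order_cong[OF j inc_embedding[OF A] B ext_local_order[OF A] F(2) b(1) _
        y(2,3) F(3)[OF that]] b(2)[OF that] y(1) by simp
  then show ?thesis
    using y(1) by (auto simp: realized_in_def)
qed

section \<open>Borel measurability\<close>

text \<open>Codes are built from functions into \<open>bool\<close>, and second countability lets
  measurability into such products be checked coordinate by coordinate.\<close>

instance bool :: second_countable_topology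
proof
  show "\<exists>B :: bool set set. countable B \<and> open = generate_topology B"
    by (intro exI[of _ UNIV] conjI) (auto simp: fun_eq_iff open_discrete intro: generate_topology.Basis)
qed

lemma pred_ext_universe [measurable]:
  "Measurable.pred borel (\<lambda>A. y \<in> ext_universe A)"
proof -
  \<comment> \<open>Emptiness of the universe is written as a quantifier over natural numbers, hence
    as a countable intersection of Borel conditions.\<close>
  have "y \<in> ext_universe A \<longleftrightarrow>
      (if \<forall>n. \<not> n \<in> universe A then site y = 0 else site y \<in> universe A) \<and>
      (tier y = 0 \<longrightarrow> site y \<in> universe A)" for A
    by (auto simp: ext_universe_def base_def)
  then show ?thesis by (simp only:) measurable
qed

lemma pred_ext_arrow [measurable]:
  "Measurable.pred borel (\<lambda>A. ext_arrow A x y)"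
  unfolding ext_arrow_def arrow_def by measurable

text \<open>\<open>Measurable.pred\<close> refers to the counting space; it has the same sets as
  \<open>borel\<close> because \<open>bool\<close> is countable and discrete.\<close>

lemma borel_measurable_bool:
  assumes "Measurable.pred M P"
  shows "P \<in> borel_measurable M"
  using assms by (simp add: measurable_cong_sets[OF refl sets_borel_eq_count_space])

lemma borel_measurable_nat_comp:
  fixes f :: "'a \<Rightarrow> nat" and h :: "nat \<Rightarrow> nat"
  assumes "f \<in> borel_measurable M"
  shows "(\<lambda>x. h (f x)) \<in> borel_measurable M"
  using assms by (simp add: measurable_cong_sets[OF refl sets_borel_eq_count_space])

lemma ext_measurable: "ext \<in> borel \<rightarrow>\<^sub>M borel"
proof -
  have "(\<lambda>A y. y \<in> ext_universe A) \<in> borel \<rightarrow>\<^sub>M borel"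
    by (intro measurable_coordinatewise_then_product borel_measurable_bool) measurable
  moreover have "(\<lambda>A (r::unit) xs. length xs = 2 \<and> set xs \<subseteq> ext_universe A \<and>
      ext_arrow A (xs ! 0) (xs ! 1)) \<in> borel \<rightarrow>\<^sub>M borel"
    unfolding subset_eq
    by (intro measurable_coordinatewise_then_product borel_measurable_bool) measurable
  ultimately show ?thesis
    unfolding ext_def[abs_def] by (rule borel_measurable_Pair)
qed

lemma inc_measurable: "inc \<in> borel \<rightarrow>\<^sub>M borel"
  unfolding inc_def[abs_def] restrict_def
  by (intro measurable_coordinatewise_then_product) measurable

text \<open>A fixed coordinate of the lift depends on one value of the automorphism and on two
  membership conditions, each Borel in the pair.\<close>

lemma lift_measurable: "(\<lambda>(A, \<phi>). lift \<sigma> A \<phi>) \<in> borel \<rightarrow>\<^sub>M borel"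
proof -
  have fst: "fst \<in> borel \<rightarrow>\<^sub>M (borel :: unit code measure)"
    by (intro borel_measurable_continuous_onI continuous_intros)
  have snd: "(\<lambda>p. snd p n) \<in> (borel :: (unit code \<times> (nat \<Rightarrow> nat)) measure) \<rightarrow>\<^sub>M borel" for n
    by (intro borel_measurable_continuous_onI
        continuous_on_product_then_coordinatewise[OF continuous_on_snd[OF continuous_on_id]])
  have [measurable]: "Measurable.pred borel (\<lambda>p :: unit code \<times> (nat \<Rightarrow> nat). y \<in> ext_universe (fst p))"
    "Measurable.pred borel (\<lambda>p :: unit code \<times> (nat \<Rightarrow> nat). y \<in> universe (fst p))" for y
    by (rule measurable_compose[OF fst pred_ext_universe], rule measurable_compose[OF fst pred_universe])
  have [measurable]: "(\<lambda>p :: unit code \<times> (nat \<Rightarrow> nat). prod_encode (snd p n, k)) \<in> borel \<rightarrow>\<^sub>M borel" for n k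
    using borel_measurable_nat_comp[OF snd] .
  have eq: "(\<lambda>(A, \<phi>). lift \<sigma> A \<phi>) = (\<lambda>p y. if y \<in> ext_universe (fst p)
      then if site y \<in> universe (fst p) then prod_encode (snd p (site y), \<sigma> (tier y))
        else prod_encode (site y, \<sigma> (tier y))
      else undefined)"
    by (auto simp: lift_def site_map_def fun_eq_iff)
  show ?thesis
    unfolding eq by (intro measurable_coordinatewise_then_product) measurable
qed

section \<open>Assembly of the amalgamation property\<close>

theorem theorem4p1:
  shows "ABAP arrow_arity countable_local_orders"
  unfolding ABAP_def
proof (intro exI conjI ballI allI impI)
  let ?K = countable_local_orders
  let ?til = "\<lambda>(A, \<phi>). lift tier_shift A \<phi>"
  show "ext \<in> restrict_space borel ?K \<rightarrow>\<^sub>M restrict_space borel ?K"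
    by (intro measurable_restrict_space3 ext_measurable) (auto intro: ext_local_order)
  show "inc \<in> restrict_space borel ?K \<rightarrow>\<^sub>M borel"
    by (intro measurable_restrict_space1 inc_measurable)
  show "?til \<in> restrict_space borel (automorphism_pairs ?K) \<rightarrow>\<^sub>M borel"
    by (intro measurable_restrict_space1 lift_measurable)
next
  fix A assume A: "A \<in> countable_local_orders"
  show "ext A \<in> countable_local_orders" "embedding A (ext A) (inc A)"
    using A by (rule ext_local_order, rule inc_embedding)
  show "realized_in (ext A) (inc A) \<tau>"
    if "admissible_type arrow_arity countable_local_orders A \<tau>" for \<tau>
    using ext_realizes A that .
  have S: "A \<in> structures arrow_arity" using A by (simp add: countable_local_orders_def)
  fix \<phi> assume \<phi>: "\<phi> \<in> Aut A"
  have \<phi>A: "\<phi> x \<in> universe A" if "x \<in> universe A" for x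
    using \<phi> that by (auto simp: Aut_def Iso_def)
  show "(case (A, \<phi>) of (A, \<phi>) \<Rightarrow> lift tier_shift A \<phi>) \<in> Aut (ext A)"
    using \<phi> unfolding Aut_def
    by (simp add: lift_Iso S bij_tier_shift tier_less_shift flipped_shift)
  show "(case (A, \<phi>) of (A, \<phi>) \<Rightarrow> lift tier_shift A \<phi>) (inc A x) = inc A (\<phi> x)"
    if "x \<in> universe A" for x
    using lift_inc[where \<sigma> = tier_shift] that \<phi>A by simp
  \<comment> \<open>Outside the copy of \<open>A\<close> the tier is nonzero, and there the shift
    changes it.\<close>
  show "(case (A, \<phi>) of (A, \<phi>) \<Rightarrow> lift tier_shift A \<phi>) y \<noteq> y"
    if "y \<in> universe (ext A) - inc A ` universe A" for y
    using that tier_shift_neq[of "tier y"] unfolding inc_image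
    by (auto simp: lift_def dest: arg_cong[of _ _ tier])
next
  fix A0 A1 \<alpha> assume A: "A0 \<in> countable_local_orders" "A1 \<in> countable_local_orders"
    and \<alpha>: "\<alpha> \<in> Iso A0 A1"
  have S: "A0 \<in> structures arrow_arity" "A1 \<in> structures arrow_arity"
    using A by (simp_all add: countable_local_orders_def)
  have \<alpha>A: "\<alpha> x \<in> universe A1" if "x \<in> universe A0" for x
    using \<alpha> that by (auto simp: Iso_def)
  \<comment> \<open>The hat leaves tiers alone, even when \<alpha> is an automorphism; only the
    tilde map shifts them.\<close>
  show iso: "lift id A0 \<alpha> \<in> Iso (ext A0) (ext A1)"
    using \<alpha> by (simp add: lift_Iso S)
  show "lift id A0 \<alpha> (inc A0 x) = inc A1 (\<alpha> x)" if "x \<in> universe A0" for x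
    using lift_inc[where \<sigma> = id] that \<alpha>A by simp
  fix \<phi>0 \<phi>1 y
  assume \<phi>: "\<phi>0 \<in> Aut A0" "\<phi>1 \<in> Aut A1" and comm: "\<forall>x\<in>universe A0. \<alpha> (\<phi>0 x) = \<phi>1 (\<alpha> x)"
    and y: "y \<in> universe (ext A0)"
  have til: "lift tier_shift A0 \<phi>0 \<in> Iso (ext A0) (ext A0)"
    using \<phi>(1) unfolding Aut_def
    by (simp add: lift_Iso S bij_tier_shift tier_less_shift flipped_shift)
  have in_ext: "lift tier_shift A0 \<phi>0 y \<in> ext_universe A0" "lift id A0 \<alpha> y \<in> ext_universe A1"
    using til iso y unfolding Iso_def embedding_def by auto
  \<comment> \<open>Both composites shift the tier once, so only the sites are compared. All maps
    preserve membership in the universes, hence the commutation hypothesis applies at real sites,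
    and the phantom site is fixed throughout.\<close>
  have "site_map A0 \<alpha> (site_map A0 \<phi>0 a) = site_map A1 \<phi>1 (site_map A0 \<alpha> a)" if "a \<in> base A0" for a
    using that comm site_map_bij(2)[OF \<phi>(1)[unfolded Aut_def] that] site_map_bij(2)[OF \<alpha> that]
    by (auto simp: site_map_def)
  then show "lift id A0 \<alpha> ((case (A0, \<phi>0) of (A, \<phi>) \<Rightarrow> lift tier_shift A \<phi>) y) =
      (case (A1, \<phi>1) of (A, \<phi>) \<Rightarrow> lift tier_shift A \<phi>) (lift id A0 \<alpha> y)"
    using y in_ext by (simp add: lift_def ext_universe_def)
qed

end
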